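(* Let $V$ be an AM-algebra with unit $\mathbf{e}$, let $\operatorname{int}(V_+)$ be the $\|\cdot\|_{\mathbf{e}}$-interior of $V_+$, and let $\tilde\rho:\operatorname{int}(V_+)\to(0,\infty]$ be a return risk measure. Then $\tilde\rho$ takes values in $(0,\infty)$ and $\tilde\rho$ is locally Lipschitz-continuous (with respect to $\|\cdot\|_{\mathbf{e}}$; i.e. every point of $\operatorname{int}(V_+)$ has a neighborhood on which $\tilde\rho$ is Lipschitz). In particular, if $\tilde\rho$ is GG-convex, then $\tilde\rho$ is lower semicontinuous in the relative topology on $\operatorname{int}(V_+)$ of the topology $\tau$ on $V$ induced by $\|\cdot\|_{\mathbf{e}}$.
   Context: An AM-space with unit $\mathbf{e}$ is a Banach lattice $V$ with order unit $\mathbf{e}$ (i.e. $\mathbf{e}>0$ and for every $x$ there is $\lambda>0$ with $|x|\le\lambda\mathbf{e}$) equipped with the norm $\|x\|_{\mathbf{e}}=\inf\{\lambda>0:|x|\le\lambda\mathbf{e}\}$; $V_+=\{x:x\ge0\}$. An AM-algebra with unit $\mathbf{e}$ is an AM-space with unit $\mathbf{e}$ that is also a real associative algebra such that products of positive elements are positive, the norm is submultiplicative, and $\mathbf{e}$ is also the multiplicative identity. There are a compact Hausdorff $K$ and a surjective lattice and algebra isometry $\Phi:V\to C(K)$ (pointwise operations) with $\Phi(\mathbf{e})=\mathbf{1}_K$; powers are $x^t=\Phi^{-1}((\Phi(x))^t)$ for $x\in V_+,t\ge0$. A map $\tilde\rho:\operatorname{int}(V_+)\to(0,\infty]$ is a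 return risk measure if it is monotone ($x\le y\Rightarrow\tilde\rho(x)\le\tilde\rho(y)$) and positively homogeneous ($\tilde\rho(\lambda x)=\lambda\tilde\rho(x)$ for all $\lambda\in(0,\infty)$). It is GG-convex if $\tilde\rho(x^\lambda y^{1-\lambda})\le\tilde\rho(x)^\lambda\tilde\rho(y)^{1-\lambda}$ for all $x,y$ and $\lambda\in(0,1)$ (with $\infty^\lambda=\infty$).
   Formalization: The claims that the return risk measure takes values in (0,∞) and is locally Lipschitz are stated assuming it is finite at some point of int(V_+), since the constant ∞ is a return risk measure and violates finiteness; the lower semicontinuity claim needs no such assumption. *)

theory Defs
  imports "HOL-Analysis.Analysis" "HOL-Library.Lattice_Algebras"
begin

class banach_lattice = banach + ordered_real_vector + lattice_ab_group_add_abs +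
  assumes norm_abs_mono: "\<bar>x\<bar> \<le> \<bar>y\<bar> \<Longrightarrow> norm x \<le> norm y"

definition (in banach_lattice) order_unit :: "'a \<Rightarrow> bool" where
  "order_unit e \<longleftrightarrow> 0 < e \<and> (\<forall>x. \<exists>c>0. \<bar>x\<bar> \<le> c *\<^sub>R e)"

definition (in banach_lattice) order_unit_norm :: "'a \<Rightarrow> 'a \<Rightarrow> real" where
  "order_unit_norm e x = Inf {c. 0 < c \<and> \<bar>x\<bar> \<le> c *\<^sub>R e}"

definition (in banach_lattice) am_space_unit :: "'a \<Rightarrow> bool" where
  "am_space_unit e \<longleftrightarrow> order_unit e \<and> (\<forall>x. norm x = order_unit_norm e x)"

(* The order unit is the multiplicative identity, hence written 1.  Associativity, bilinearity and
   submultiplicativity of the norm come from real_normed_algebra_1; its axiom norm 1 = 1 is no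
   restriction, since the order unit norm of the unit is 1. *)
class am_algebra = banach_lattice + real_normed_algebra_1 +
  assumes am_space_unit_one: "am_space_unit 1"
    and times_nonneg: "0 \<le> x \<Longrightarrow> 0 \<le> y \<Longrightarrow> 0 \<le> x * y"

definition pos_interior :: "'a::am_algebra set" where
  "pos_interior = interior {x. 0 \<le> x}"

(* C(K) for a topological space K; functions are fixed to be undefined off the space, so that
   distinct elements of cont_fun K are distinct continuous functions on K. *)
definition cont_fun :: "'k topology \<Rightarrow> ('k \<Rightarrow> real) set" where
  "cont_fun K = {f \<in> extensional (topspace K). continuous_map K euclideanreal f}"

(* The clauses at each point k are the lattice and algebra homomorphism property for the
   pointwise operations; the last clause is the isometry property for the supremum norm. *)
definition am_representation :: "'k topology \<Rightarrow> ('a::am_algebra \<Rightarrow> 'k \<Rightarrow> real) \<Rightarrow> bool" where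
  "am_representation K \<Phi> \<longleftrightarrow>
     compact_space K \<and> Hausdorff_space K \<and> \<Phi> ` UNIV = cont_fun K \<and>
     (\<forall>k\<in>topspace K.
        (\<forall>x y. \<Phi> (x + y) k = \<Phi> x k + \<Phi> y k) \<and>
        (\<forall>c x. \<Phi> (c *\<^sub>R x) k = c * \<Phi> x k) \<and>
        (\<forall>x y. \<Phi> (x * y) k = \<Phi> x k * \<Phi> y k) \<and>
        (\<forall>x y. \<Phi> (sup x y) k = max (\<Phi> x k) (\<Phi> y k)) \<and>
        (\<forall>x y. \<Phi> (inf x y) k = min (\<Phi> x k) (\<Phi> y k)) \<and>
        \<Phi> 1 k = 1) \<and>
     (\<forall>x. norm x = (SUP k\<in>topspace K. \<bar>\<Phi> x k\<bar>))"

(* Meant for 0 \<le> x and 0 \<le> t.  The case t = 0 is separate because 0 powr 0 = 0. *)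
definition am_power :: "'k topology \<Rightarrow> ('a::am_algebra \<Rightarrow> 'k \<Rightarrow> real) \<Rightarrow> 'a \<Rightarrow> real \<Rightarrow> 'a" where
  "am_power K \<Phi> x t = inv \<Phi> (\<lambda>k\<in>topspace K. if t = 0 then 1 else \<Phi> x k powr t)"

(* Only the values on pos_interior are meaningful.  The constant infinity satisfies this definition, so
   finiteness of a return risk measure needs one finite value on pos_interior. *)
definition return_risk_measure :: "('a::am_algebra \<Rightarrow> ennreal) \<Rightarrow> bool" where
  "return_risk_measure \<rho> \<longleftrightarrow>
     (\<forall>x\<in>pos_interior. 0 < \<rho> x) \<and>
     (\<forall>x\<in>pos_interior. \<forall>y\<in>pos_interior. x \<le> y \<longrightarrow> \<rho> x \<le> \<rho> y) \<and>
     (\<forall>x\<in>pos_interior. \<forall>c>0. \<rho> (c *\<^sub>R x) = ennreal c * \<rho> x)"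

(* Meant for exponents t > 0. *)
definition ennreal_powr :: "ennreal \<Rightarrow> real \<Rightarrow> ennreal" where
  "ennreal_powr a t = (if a = \<infinity> then \<infinity> else ennreal (enn2real a powr t))"

definition GG_convex ::
    "'k topology \<Rightarrow> ('a::am_algebra \<Rightarrow> 'k \<Rightarrow> real) \<Rightarrow> ('a \<Rightarrow> ennreal) \<Rightarrow> bool" where
  "GG_convex K \<Phi> \<rho> \<longleftrightarrow>
     (\<forall>x\<in>pos_interior. \<forall>y\<in>pos_interior. \<forall>t\<in>{0<..<1}.
        \<rho> (am_power K \<Phi> x t * am_power K \<Phi> y (1 - t))
          \<le> ennreal_powr (\<rho> x) t * ennreal_powr (\<rho> y) (1 - t))"

definition locally_lipschitz_on ::
    "'a::metric_space set \<Rightarrow> ('a \<Rightarrow> 'b::metric_space) \<Rightarrow> bool" where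
  "locally_lipschitz_on S f \<longleftrightarrow>
     (\<forall>x\<in>S. \<exists>U L. openin (top_of_set S) U \<and> x \<in> U \<and> L-lipschitz_on U f)"

definition lower_semicontinuous_on :: "'a::topological_space set \<Rightarrow> ('a \<Rightarrow> ennreal) \<Rightarrow> bool" where
  "lower_semicontinuous_on S f \<longleftrightarrow> (\<forall>c. closedin (top_of_set S) {x \<in> S. f x \<le> c})"

end

theory Submission
  imports Defs
begin

text \<open>If \<open>x \<ge> \<delta> \<cdot> 1\<close>, then any \<open>y\<close> satisfies \<open>y \<le> x + c \<cdot> 1 \<le> (1 + c / \<delta>) x\<close> as soon as
  \<open>c > \<parallel>y - x\<parallel>\<close>. Monotonicity and positive homogeneity turn this into
  \<open>\<rho> y \<le> (1 + c / \<delta>) \<rho> x\<close>, which gives both the propagation of finiteness from one point to all others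
  and the local Lipschitz estimate. A return risk measure is thus either continuous or identically
  infinite, and hence lower semicontinuous.\<close>

text \<open>The strict bound provides an admissible coefficient below \<open>c\<close>, so
  attainment of the infimum in \<open>order_unit_norm\<close> never enters; \<open>0 \<le> 1\<close>
  makes the admissible coefficients upward closed.\<close>

lemma abs_le_scaleR_one:
  fixes x :: "'a::am_algebra"
  assumes "norm x < c"
  shows "\<bar>x\<bar> \<le> c *\<^sub>R 1"
proof -
  let ?S = "{c. 0 < c \<and> \<bar>x\<bar> \<le> c *\<^sub>R (1::'a)}"
  have unit: "order_unit (1::'a)" and norm: "norm x = Inf ?S"
    using am_space_unit_one by (auto simp: am_space_unit_def order_unit_norm_def)
  have "?S \<noteq> {}"
    using unit by (auto simp: order_unit_def)
  then obtain d where "d \<in> ?S" "d < c"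
    using assms norm cInf_lessD by metis
  moreover have "0 \<le> (1::'a)"
    using unit by (simp add: order_unit_def less_imp_le)
  ultimately show ?thesis
    using scaleR_right_mono[of d c "1::'a"] by (auto intro: order_trans)
qed

lemma le_add_scaleR_one:
  fixes x y :: "'a::am_algebra"
  assumes "dist y x < c"
  shows "y \<le> x + c *\<^sub>R 1"
proof -
  have "y - x \<le> \<bar>y - x\<bar>"
    by (rule abs_ge_self)
  also have "\<dots> \<le> c *\<^sub>R 1"
    using assms by (intro abs_le_scaleR_one) (simp add: dist_norm)
  finally show ?thesis
    by (simp add: algebra_simps)
qed

text \<open>A ball in the order unit norm is an order interval up to its boundary: a ball inside the
  cone leaves room to subtract a multiple of the unit, and conversely moving by less than
  \<open>d\<close> costs at most \<open>d *\<^sub>R 1\<close>.\<close>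

lemma pos_interior_iff:
  fixes x :: "'a::am_algebra"
  shows "x \<in> pos_interior \<longleftrightarrow> (\<exists>d>0. d *\<^sub>R 1 \<le> x)"
proof
  assume "x \<in> pos_interior"
  then obtain r where r: "r > 0" "cball x r \<subseteq> {x. 0 \<le> x}"
    unfolding pos_interior_def mem_interior_cball by blast
  \<comment> \<open>As \<open>norm 1 = 1\<close>, this point is at distance exactly
    \<open>r\<close>, hence the closed ball.\<close>
  have "x - r *\<^sub>R 1 \<in> cball x r"
    using r by (simp add: dist_norm)
  then have "0 \<le> x - r *\<^sub>R 1"
    using r by blast
  then show "\<exists>d>0. d *\<^sub>R 1 \<le> x"
    using r by auto
next
  assume "\<exists>d>0. d *\<^sub>R 1 \<le> x"
  then obtain d where d: "d > 0" "d *\<^sub>R 1 \<le> x"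
    by blast
  have "0 \<le> y" if "y \<in> ball x d" for y
  proof -
    have "d *\<^sub>R 1 \<le> y + d *\<^sub>R 1"
      using that by (intro order_trans[OF d(2) le_add_scaleR_one]) simp
    then show ?thesis by simp
  qed
  then show "x \<in> pos_interior"
    unfolding pos_interior_def mem_interior using d(1) by blast
qed

lemma open_pos_interior: "open pos_interior"
  by (simp add: pos_interior_def)

lemma le_scaleR_of_dist_less:
  fixes x y :: "'a::am_algebra"
  assumes "d > 0" "d *\<^sub>R 1 \<le> x" "dist y x < c"
  shows "y \<le> (1 + c / d) *\<^sub>R x"
proof -
  have "0 \<le> c / d"
    using assms(1) zero_le_dist[of y x] assms(3) by (intro divide_nonneg_pos) linarith+
  have "c *\<^sub>R 1 = (c / d) *\<^sub>R (d *\<^sub>R (1::'a))"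
    using assms(1) by simp
  also have "\<dots> \<le> (c / d) *\<^sub>R x"
    using assms(2) \<open>0 \<le> c / d\<close> by (rule scaleR_left_mono)
  finally have "x + c *\<^sub>R 1 \<le> (1 + c / d) *\<^sub>R x"
    by (simp add: scaleR_left_distrib)
  then show ?thesis
    using le_add_scaleR_one[OF assms(3)] by (rule order_trans[rotated])
qed

lemma pos_interior_scaleR:
  fixes x :: "'a::am_algebra"
  assumes "x \<in> pos_interior" "c > 0"
  shows "c *\<^sub>R x \<in> pos_interior"
proof -
  obtain d where d: "d > 0" "d *\<^sub>R 1 \<le> x"
    using assms(1) pos_interior_iff by blast
  then have "(c * d) *\<^sub>R 1 \<le> c *\<^sub>R x"
    using assms(2) scaleR_left_mono[of "d *\<^sub>R 1" x c] by simp
  then show ?thesis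
    using d(1) assms(2) pos_interior_iff mult_pos_pos by blast
qed

lemma return_risk_measure_le:
  fixes x y :: "'a::am_algebra"
  assumes "return_risk_measure \<rho>" "x \<in> pos_interior" "y \<in> pos_interior"
    and "d > 0" "d *\<^sub>R 1 \<le> x" "dist y x < c"
  shows "\<rho> y \<le> ennreal (1 + c / d) * \<rho> x"
proof -
  have "0 < 1 + c / d"
    using assms(4) zero_le_dist[of y x] assms(6) by (intro add_pos_nonneg divide_nonneg_pos) linarith+
  moreover from this have "\<rho> y \<le> \<rho> ((1 + c / d) *\<^sub>R x)"
    using assms le_scaleR_of_dist_less[OF assms(4-6)] pos_interior_scaleR
    unfolding return_risk_measure_def by blast
  ultimately show ?thesis
    using assms(1,2) unfolding return_risk_measure_def by metis
qed

lemma return_risk_measure_finite: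
  fixes x y :: "'a::am_algebra"
  assumes "return_risk_measure \<rho>" "x \<in> pos_interior" "y \<in> pos_interior" "\<rho> x < \<infinity>"
  shows "\<rho> y < \<infinity>"
proof -
  obtain d where "d > 0" "d *\<^sub>R 1 \<le> x"
    using assms(2) pos_interior_iff by blast
  \<comment> \<open>Any real above \<open>dist y x\<close> would serve; only finiteness of the
    factor matters.\<close>
  then have "\<rho> y \<le> ennreal (1 + (dist y x + 1) / d) * \<rho> x"
    using assms by (intro return_risk_measure_le) auto
  also have "\<dots> < \<infinity>"
    using assms(4) by (simp add: ennreal_mult_less_top)
  finally show ?thesis .
qed

text \<open>Near \<open>x\<close> one multiple \<open>d *\<^sub>R 1\<close> bounds all points from
  below. The multiplicative estimate then gives differences of at most \<open>dist y z / d\<close>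
  times a value of the function, and those values are bounded by \<open>2 * f x\<close>.\<close>

lemma return_risk_measure_locally_lipschitz:
  fixes \<rho> :: "'a::am_algebra \<Rightarrow> ennreal"
  assumes \<rho>: "return_risk_measure \<rho>" and fin: "\<And>x. x \<in> pos_interior \<Longrightarrow> \<rho> x < \<infinity>"
  shows "locally_lipschitz_on pos_interior (\<lambda>x. enn2real (\<rho> x))"
  unfolding locally_lipschitz_on_def
proof
  fix x :: 'a
  assume x: "x \<in> pos_interior"
  define f where "f = (\<lambda>x. enn2real (\<rho> x))"
  have f_le: "f z \<le> (1 + c / d) * f y"
    if "y \<in> pos_interior" "z \<in> pos_interior" "d > 0" "d *\<^sub>R 1 \<le> y" "dist z y < c" for y z c d
  proof -
    have "0 \<le> c / d"
      using that(3) zero_le_dist[of z y] that(5) by (intro divide_nonneg_pos) linarith+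
    \<comment> \<open>The right-hand side must be finite here: \<open>enn2real\<close> sends
      infinity to 0 and is monotone only below it.\<close>
    moreover have "f z \<le> enn2real (ennreal (1 + c / d) * \<rho> y)"
      unfolding f_def using that fin return_risk_measure_le[OF \<rho> that]
      by (intro enn2real_mono) (auto simp: ennreal_mult_less_top)
    ultimately show ?thesis
      by (simp add: f_def enn2real_mult del: ennreal_plus)
  qed
  obtain e where e: "e > 0" "e *\<^sub>R 1 \<le> x"
    using x pos_interior_iff by blast
  \<comment> \<open>Half of the lower bound on \<open>x\<close> is spent on the radius of the ball;
    the other half survives as a lower bound on all of \<open>U\<close>.\<close>
  define d where "d = e / 2"
  have d: "d > 0" "d *\<^sub>R 1 + d *\<^sub>R 1 \<le> x"
    using e by (simp_all add: d_def flip: scaleR_left_distrib)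
  define U where "U = pos_interior \<inter> ball x d"
  have below: "d *\<^sub>R 1 \<le> y" if "y \<in> U" for y
  proof -
    have "d *\<^sub>R 1 + d *\<^sub>R 1 \<le> y + d *\<^sub>R 1"
      using that by (intro order_trans[OF d(2) le_add_scaleR_one]) (simp add: U_def)
    then show ?thesis by simp
  qed
  \<comment> \<open>Taking the radius \<open>d\<close> for \<open>c\<close> turns the factor
    \<open>1 + c / d\<close> into 2.\<close>
  have bound: "f y \<le> 2 * f x" if "y \<in> U" for y
  proof -
    have "d *\<^sub>R 1 \<le> x"
      using below[of x] x d(1) by (simp add: U_def)
    then show ?thesis
      using f_le[of x y d d] that x d(1) by (simp add: U_def dist_commute)
  qed
  define L where "L = 2 * f x / d"
  have L: "0 \<le> L"
    using d(1) by (simp add: L_def f_def)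
  have diff: "f y - f z \<le> L * dist y z" if y: "y \<in> U" and z: "z \<in> U" for y z
  proof (rule field_le_epsilon)
    fix \<epsilon> :: real
    assume "\<epsilon> > 0"
    \<comment> \<open>\<open>f_le\<close> needs \<open>c\<close> strictly above the distance. The
      excess contributes \<open>\<epsilon> * (L / (L + 1))\<close>, at most \<epsilon>; the summand
      1 keeps the denominator positive when only \<open>0 \<le> L\<close> is known.\<close>
    define c where "c = dist y z + \<epsilon> / (L + 1)"
    have c: "dist y z < c"
      using \<open>\<epsilon> > 0\<close> L by (simp add: c_def)
    have "f y - f z \<le> c / d * f z"
      using f_le[of z y d c] y z below[OF z] d(1) c by (simp add: U_def algebra_simps)
    also have "\<dots> \<le> c / d * (2 * f x)"
      using bound[OF z] d(1) c zero_le_dist[of y z]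
      by (intro mult_left_mono divide_nonneg_pos) linarith+
    also have "\<dots> = L * dist y z + \<epsilon> * (L / (L + 1))"
      by (simp add: L_def c_def field_simps)
    also have "\<dots> \<le> L * dist y z + \<epsilon> * 1"
      using L \<open>\<epsilon> > 0\<close> by (intro add_left_mono mult_left_mono) auto
    finally show "f y - f z \<le> L * dist y z + \<epsilon>"
      by simp
  qed
  have "L-lipschitz_on U f"
  proof (rule lipschitz_onI[OF _ L])
    fix y z
    assume "y \<in> U" "z \<in> U"
    then show "dist (f y) (f z) \<le> L * dist y z"
      using diff[of y z] diff[of z y] by (simp add: dist_real_def dist_commute abs_le_iff)
  qed
  moreover have "openin (top_of_set pos_interior) U" "x \<in> U"
    using x d(1) by (auto simp: U_def)
  ultimately show "\<exists>U L. openin (top_of_set pos_interior) U \<and> x \<in> U \<and>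
      L-lipschitz_on U (\<lambda>x. enn2real (\<rho> x))"
    unfolding f_def by blast
qed

lemma locally_lipschitz_on_imp_continuous_on:
  assumes "locally_lipschitz_on S f" "open S"
  shows "continuous_on S f"
proof (rule continuous_at_imp_continuous_on, rule ballI)
  fix x
  assume "x \<in> S"
  then obtain U L where U: "openin (top_of_set S) U" "x \<in> U" "L-lipschitz_on U f"
    using assms(1) unfolding locally_lipschitz_on_def by blast
  \<comment> \<open>Openness in the whole space turns continuity on \<open>U\<close> into continuity
    at \<open>x\<close>.\<close>
  then have "open U"
    using assms(2) openin_open_eq by blast
  then show "isCont f x"
    using U lipschitz_on_continuous_on continuous_on_eq_continuous_at by blast
qed

lemma return_risk_measure_lower_semicontinuous:
  fixes \<rho> :: "'a::am_algebra \<Rightarrow> ennreal"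
  assumes \<rho>: "return_risk_measure \<rho>"
  shows "lower_semicontinuous_on pos_interior \<rho>"
proof (cases "\<exists>x\<in>pos_interior. \<rho> x < \<infinity>")
  case True
  then have fin: "\<rho> x < \<infinity>" if "x \<in> pos_interior" for x
    using return_risk_measure_finite[OF \<rho>] that by blast
  have cont: "continuous_on pos_interior (\<lambda>x. enn2real (\<rho> x))"
    using return_risk_measure_locally_lipschitz[OF \<rho> fin] open_pos_interior
    by (rule locally_lipschitz_on_imp_continuous_on)
  show ?thesis
    unfolding lower_semicontinuous_on_def
  proof
    fix c
    show "closedin (top_of_set pos_interior) {x \<in> pos_interior. \<rho> x \<le> c}"
    \<comment> \<open>Level infinity is split off because its sublevel set is all of
      \<open>pos_interior\<close>, whereas \<open>enn2real\<close> would read that level as 0. For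
      finite \<open>c\<close> the comparison takes place in the reals.\<close>
    proof (cases "c = \<infinity>")
      case True
      then show ?thesis by simp
    next
      case False
      have "\<rho> x \<le> c \<longleftrightarrow> enn2real (\<rho> x) \<le> enn2real c" if "x \<in> pos_interior" for x
      proof -
        have "\<rho> x = ennreal (enn2real (\<rho> x))" "c = ennreal (enn2real c)"
          using fin[OF that] False by (simp_all add: top.not_eq_extremum)
        then show ?thesis
          using ennreal_le_iff[OF enn2real_nonneg] by metis
      qed
      then have "{x \<in> pos_interior. \<rho> x \<le> c} = pos_interior \<inter> (\<lambda>x. enn2real (\<rho> x)) -` {..enn2real c}"
        by auto
      then show ?thesis
        using continuous_closedin_preimage[OF cont closed_atMost] by simp
    qed
  qed
next
  case False
  then have "\<rho> x = \<infinity>" if "x \<in> pos_interior" for x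
    using that top.not_eq_extremum by auto
  \<comment> \<open>Both possible sublevel sets of the constant infinity are relatively
    closed.\<close>
  then have "{x \<in> pos_interior. \<rho> x \<le> c} = (if c = \<infinity> then pos_interior else {})" for c
    by (auto simp: top_unique)
  then show ?thesis
    by (simp add: lower_semicontinuous_on_def)
qed

theorem theorem3p1:
  fixes \<rho> :: "'a::am_algebra \<Rightarrow> ennreal"
    and K :: "'k topology"
    and \<Phi> :: "'a \<Rightarrow> 'k \<Rightarrow> real"
  assumes "return_risk_measure \<rho>"
  shows "((\<exists>x\<in>pos_interior. \<rho> x < \<infinity>) \<longrightarrow>
            (\<forall>x\<in>pos_interior. 0 < \<rho> x \<and> \<rho> x < \<infinity>) \<and>
            locally_lipschitz_on pos_interior (\<lambda>x. enn2real (\<rho> x))) \<and>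
         (am_representation K \<Phi> \<and> GG_convex K \<Phi> \<rho> \<longrightarrow>
            lower_semicontinuous_on pos_interior \<rho>)"
proof (intro conjI impI)
  assume "\<exists>x\<in>pos_interior. \<rho> x < \<infinity>"
  then have fin: "\<rho> x < \<infinity>" if "x \<in> pos_interior" for x
    using return_risk_measure_finite[OF assms] that by blast
  then show "\<forall>x\<in>pos_interior. 0 < \<rho> x \<and> \<rho> x < \<infinity>"
    using assms by (simp add: return_risk_measure_def)
  show "locally_lipschitz_on pos_interior (\<lambda>x. enn2real (\<rho> x))"
    using assms fin by (rule return_risk_measure_locally_lipschitz)
next
  show "lower_semicontinuous_on pos_interior \<rho>"
    using assms by (rule return_risk_measure_lower_semicontinuous)
qed

end
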